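(* Let $H$ be a bipartite graph. There exist constants $0<\varepsilon_H\le \frac12$ and $c_H>1$, depending only on $H$, such that for every integer $s\ge 1$ and every positive integer $n$, $\mathrm{ex}(n,K_{s,s},H\text{-ind})\le c_H s^4 n^{2-\varepsilon_H}$.
   Context: For graphs $F,H$, $\mathrm{ex}(n,F,H\text{-ind})$ denotes the maximum number of edges of an $n$-vertex graph that contains neither $F$ as a (not necessarily induced) subgraph nor $H$ as an induced subgraph. *)

theory Defs
  imports Complex_Main "Graph_Theory.Graph_Theory"
begin

text \<open>
  Following \<^theory>\<open>Graph_Theory.Digraph\<close>, a finite simple graph is a finite loopless
  symmetric digraph without parallel arcs (locale \<^locale>\<open>pair_graph\<close>). Each undirected
  edge is therefore a pair of opposite arcs, and edges have to be counted after forgetting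
  the orientation.
\<close>

definition edges :: "'a pair_pre_digraph \<Rightarrow> 'a set set" where
  "edges G = {{u, v} | u v. (u, v) \<in> parcs G}"

definition bipartite :: "'a pair_pre_digraph \<Rightarrow> bool" where
  "bipartite G \<longleftrightarrow> (\<exists>A B. pverts G = A \<union> B \<and> A \<inter> B = {} \<and> parcs G \<subseteq> A \<times> B \<union> B \<times> A)"

definition contains_subgraph :: "'a pair_pre_digraph \<Rightarrow> 'b pair_pre_digraph \<Rightarrow> bool" where
  "contains_subgraph G F \<longleftrightarrow>
     (\<exists>F'. subgraph F' (with_proj G) \<and> digraph_iso (with_proj F) F')"

definition contains_induced :: "'a pair_pre_digraph \<Rightarrow> 'b pair_pre_digraph \<Rightarrow> bool" where
  "contains_induced G H \<longleftrightarrow>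
     (\<exists>H'. induced_subgraph H' (with_proj G) \<and> digraph_iso (with_proj H) H')"

definition complete_bipartite :: "nat \<Rightarrow> nat \<Rightarrow> (nat + nat) pair_pre_digraph" where
  "complete_bipartite s t =
     \<lparr> pverts = Inl ` {..<s} \<union> Inr ` {..<t},
       parcs = Inl ` {..<s} \<times> Inr ` {..<t} \<union> Inr ` {..<t} \<times> Inl ` {..<s} \<rparr>"

text \<open>
  The graph \<open>G\<close> ranges over graphs on \<open>n\<close> natural numbers, which represent all
  \<open>n\<close>-vertex graphs up to isomorphism. There may be no admissible \<open>G\<close> at all (for example, by
  Ramsey's theorem, if \<open>H\<close> is edgeless and \<open>n\<close> is large); the maximum is then read as
  \<open>0\<close>, which is the value of the supremum of the empty set of naturals. A nonempty set of
  edge numbers is bounded by \<open>n choose 2\<close>, so its supremum is its maximum.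
\<close>

definition ex_ind :: "nat \<Rightarrow> 'a pair_pre_digraph \<Rightarrow> 'b pair_pre_digraph \<Rightarrow> nat" where
  "ex_ind n F H = Sup {card (edges G) | G :: nat pair_pre_digraph.
     pair_graph G \<and> card (pverts G) = n \<and>
     \<not> contains_subgraph G F \<and> \<not> contains_induced G H}"

lemma complete_bipartite_digraph_complete_bipartite:
  "complete_bipartite_digraph s t (with_proj (complete_bipartite s t))"
  unfolding complete_bipartite_digraph_pair_def complete_bipartite_def
proof (intro conjI exI)
  show "card (Inl ` {..<s} :: (nat + nat) set) = s" by (simp add: card_image)
  show "card (Inr ` {..<t} :: (nat + nat) set) = t" by (simp add: card_image)
qed auto

lemma contains_subgraph_iff:
  assumes "pair_graph G" "pair_graph F"
  shows "contains_subgraph G F \<longleftrightarrow>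
    (\<exists>f. inj_on f (pverts F) \<and> f ` pverts F \<subseteq> pverts G \<and>
         (\<forall>(u, v) \<in> parcs F. (f u, f v) \<in> parcs G))" (is "?L = ?R")
proof
  interpret G: pair_graph G by fact
  interpret F: pair_graph F by fact
  {
    assume ?L
    then obtain h where s: "subgraph (app_iso h (with_proj F)) (with_proj G)"
      and h: "pre_digraph.digraph_isomorphism (with_proj F) h"
      unfolding contains_subgraph_def digraph_iso_def by auto
    have t: "iso_tail h = fst" "iso_head h = snd"
      using s by (auto simp: subgraph_def compatible_def)
    have "(iso_verts h u, iso_verts h v) \<in> parcs G" if "(u, v) \<in> parcs F" for u v
    proof -
      have "iso_arcs h (u, v) \<in> parcs G" using s that by (auto simp: subgraph_def)
      moreover have "iso_arcs h (u, v) = (iso_verts h u, iso_verts h v)"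
        using h that t by (force simp: pre_digraph.digraph_isomorphism_def prod_eq_iff)
      ultimately show ?thesis by simp
    qed
    then show ?R using s h
      by (intro exI[of _ "iso_verts h"])
         (auto simp: subgraph_def pre_digraph.digraph_isomorphism_def)
  next
    assume ?R
    then obtain f where f: "inj_on f (pverts F)" "f ` pverts F \<subseteq> pverts G"
      "\<forall>(u, v) \<in> parcs F. (f u, f v) \<in> parcs G" by blast
    let ?h = "\<lparr>iso_verts = f, iso_arcs = map_prod f f, iso_head = snd, iso_tail = fst\<rparr>"
    have a: "inj_on (map_prod f f) (parcs F)"
    proof (rule inj_onI)
      fix x y assume "x \<in> parcs F" "y \<in> parcs F" "map_prod f f x = map_prod f f y"
      moreover obtain x1 x2 y1 y2 where "x = (x1, x2)" "y = (y1, y2)"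
        by (cases x, cases y)
      ultimately show "x = y"
        using f(1) F.in_arcsD1 F.in_arcsD2 by (simp add: inj_on_eq_iff)
    qed
    have h: "pre_digraph.digraph_isomorphism (with_proj F) ?h"
      using f(1) a F.wf_digraph_axioms by (auto simp: pre_digraph.digraph_isomorphism_def)
    have "subgraph (app_iso ?h (with_proj F)) (with_proj G)"
      using f F.wf_digraphI_app_iso[OF h] G.wf_digraph_axioms
      by (auto simp: subgraph_def compatible_def)
    then show ?L using h unfolding contains_subgraph_def digraph_iso_def by blast
  }
qed

lemma contains_induced_iff:
  assumes "pair_graph G" "pair_graph H"
  shows "contains_induced G H \<longleftrightarrow>
    (\<exists>f. inj_on f (pverts H) \<and> f ` pverts H \<subseteq> pverts G \<and>
         (\<forall>u \<in> pverts H. \<forall>v \<in> pverts H. (u, v) \<in> parcs H \<longleftrightarrow> (f u, f v) \<in> parcs G))" (is "?L = ?R")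
proof
  interpret G: pair_graph G by fact
  interpret H: pair_graph H by fact
  {
    assume ?L
    then obtain h where s: "induced_subgraph (app_iso h (with_proj H)) (with_proj G)"
      and h: "pre_digraph.digraph_isomorphism (with_proj H) h"
      unfolding contains_induced_def digraph_iso_def by auto
    have t: "iso_tail h = fst" "iso_head h = snd"
      using s by (auto simp: induced_subgraph_def subgraph_def compatible_def)
    have inj: "inj_on (iso_verts h) (pverts H)"
      using h by (auto simp: pre_digraph.digraph_isomorphism_def)
    have e: "iso_arcs h (u, v) = (iso_verts h u, iso_verts h v)" if "(u, v) \<in> parcs H" for u v
      using h that t by (force simp: pre_digraph.digraph_isomorphism_def prod_eq_iff)
    have i: "iso_arcs h ` parcs H =
        {e \<in> parcs G. fst e \<in> iso_verts h ` pverts H \<and> snd e \<in> iso_verts h ` pverts H}"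
      using s t by (simp add: induced_subgraph_def)
    have "(u, v) \<in> parcs H \<longleftrightarrow> (iso_verts h u, iso_verts h v) \<in> parcs G"
      if uv: "u \<in> pverts H" "v \<in> pverts H" for u v
    proof
      assume "(u, v) \<in> parcs H"
      then have "(iso_verts h u, iso_verts h v) \<in> iso_arcs h ` parcs H"
        by (intro image_eqI[of _ _ "(u, v)"]) (simp_all add: e)
      then show "(iso_verts h u, iso_verts h v) \<in> parcs G" using i by blast
    next
      assume "(iso_verts h u, iso_verts h v) \<in> parcs G"
      then have "(iso_verts h u, iso_verts h v) \<in> iso_arcs h ` parcs H"
        using i uv by auto
      then obtain u' v' where uv': "(u', v') \<in> parcs H"
        and "(iso_verts h u, iso_verts h v) = iso_arcs h (u', v')"
        by auto
      then have "iso_verts h u = iso_verts h u'" "iso_verts h v = iso_verts h v'"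
        using e[OF uv'] by simp_all
      then have "u = u'" "v = v'"
        using inj uv H.in_arcsD1[OF uv'] H.in_arcsD2[OF uv'] by (simp_all add: inj_on_eq_iff)
      then show "(u, v) \<in> parcs H" using uv' by simp
    qed
    moreover have "iso_verts h ` pverts H \<subseteq> pverts G"
      using s by (auto simp: induced_subgraph_def subgraph_def)
    ultimately show ?R using inj by blast
  next
    assume ?R
    then obtain f where f: "inj_on f (pverts H)" "f ` pverts H \<subseteq> pverts G"
      "\<forall>u \<in> pverts H. \<forall>v \<in> pverts H. (u, v) \<in> parcs H \<longleftrightarrow> (f u, f v) \<in> parcs G" by blast
    let ?h = "\<lparr>iso_verts = f, iso_arcs = map_prod f f, iso_head = snd, iso_tail = fst\<rparr>"
    have a: "inj_on (map_prod f f) (parcs H)"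
    proof (rule inj_onI)
      fix x y assume "x \<in> parcs H" "y \<in> parcs H" "map_prod f f x = map_prod f f y"
      moreover obtain x1 x2 y1 y2 where "x = (x1, x2)" "y = (y1, y2)"
        by (cases x, cases y)
      ultimately show "x = y"
        using f(1) H.in_arcsD1 H.in_arcsD2 by (simp add: inj_on_eq_iff)
    qed
    have h: "pre_digraph.digraph_isomorphism (with_proj H) ?h"
      using f(1) a H.wf_digraph_axioms by (auto simp: pre_digraph.digraph_isomorphism_def)
    have "map_prod f f ` parcs H = {e \<in> parcs G. fst e \<in> f ` pverts H \<and> snd e \<in> f ` pverts H}"
    proof (intro set_eqI iffI)
      fix e assume "e \<in> map_prod f f ` parcs H"
      then obtain u v where uv: "(u, v) \<in> parcs H" "e = (f u, f v)" by auto
      then show "e \<in> {e \<in> parcs G. fst e \<in> f ` pverts H \<and> snd e \<in> f ` pverts H}"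
        using f(3) uv H.in_arcsD1[OF uv(1)] H.in_arcsD2[OF uv(1)] by simp
    next
      fix e assume "e \<in> {e \<in> parcs G. fst e \<in> f ` pverts H \<and> snd e \<in> f ` pverts H}"
      then obtain u v where "u \<in> pverts H" "v \<in> pverts H" "e = (f u, f v)" "e \<in> parcs G"
        by (cases e) auto
      then show "e \<in> map_prod f f ` parcs H"
        using f(3) by (intro image_eqI[of _ _ "(u, v)"]) auto
    qed
    then have "induced_subgraph (app_iso ?h (with_proj H)) (with_proj G)"
      using f(2) H.wf_digraphI_app_iso[OF h] G.wf_digraph_axioms
      by (auto simp: induced_subgraph_def subgraph_def compatible_def)
    then show ?L using h unfolding contains_induced_def digraph_iso_def by blast
  }
qed

end

theory Submission
  imports Defs
begin

text \<open>
  Let \<open>A\<close>, \<open>B\<close> be the sides of \<open>H\<close>. If \<open>G\<close> has many edges, dependent random choice gives a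
  large vertex set \<open>U\<close> in which any \<open>|A|\<close> vertices have many common neighbours. In a
  \<open>K\<^sub>s\<^sub>,\<^sub>s\<close>-free graph, for every set \<open>Y\<close> of at least \<open>4s\<close> vertices, all but fewer than \<open>s\<close>
  vertices miss at least a \<open>1/(4s)\<close> fraction of \<open>Y\<close>. Hence only few maps \<open>f : A \<rightarrow> U\<close> have a
  subset \<open>S\<close> of \<open>A\<close> for which few vertices are adjacent to all of \<open>f(S)\<close> and to none of
  \<open>f(A - S)\<close>, whereas a positive (polynomial in \<open>1/s\<close>) fraction of all maps \<open>A \<rightarrow> U\<close> have
  independent injective image. Some \<open>f\<close> therefore embeds \<open>A\<close> and leaves a large candidate set for
  every \<open>b\<close> in \<open>B\<close>; an independent transversal of the candidate sets completes an induced
  copy of \<open>H\<close>. The losses are polynomial in \<open>s\<close>, and the exponent of \<open>s\<close> is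
  irrelevant: one may assume \<open>s\<^sup>4 < n\<^sup>\<epsilon>\<close>, since otherwise the bound is trivial, and
  \<open>\<epsilon>\<close> may be chosen small in terms of \<open>H\<close>.
\<close>

section \<open>Counting in biclique-free graphs\<close>

definition closed_nbh :: "('v \<times> 'v) set \<Rightarrow> 'v \<Rightarrow> 'v set" where
  "closed_nbh E x = insert x (E `` {x})"

text \<open>Avoiding closed neighbourhoods makes the chosen vertices distinct as well as
  non-adjacent, so injectivity needs no separate count. Extensionality lets \<open>card\<close>
  count choices on \<open>J\<close> only.\<close>

definition independent_transversals ::
    "('v \<times> 'v) set \<Rightarrow> 'i set \<Rightarrow> ('i \<Rightarrow> 'v set) \<Rightarrow> ('i \<Rightarrow> 'v) set" where
  "independent_transversals E J Y =
     {f \<in> Pi\<^sub>E J Y. \<forall>i\<in>J. \<forall>j\<in>J. i \<noteq> j \<longrightarrow> f j \<notin> closed_nbh E (f i)}"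

text \<open>These are the candidates for a vertex of \<open>H\<close> with neighbours
  \<open>S\<close> and non-neighbours \<open>T\<close>; for \<open>T = {}\<close> this is the common
  neighbourhood in \<open>V\<close> of the image of \<open>S\<close>.\<close>

definition extension_set ::
    "'v set \<Rightarrow> ('v \<times> 'v) set \<Rightarrow> ('i \<Rightarrow> 'v) \<Rightarrow> 'i set \<Rightarrow> 'i set \<Rightarrow> 'v set" where
  "extension_set V E f S T =
     {y \<in> V. (\<forall>i\<in>S. (f i, y) \<in> E) \<and> (\<forall>i\<in>T. y \<notin> closed_nbh E (f i))}"

locale biclique_free =
  fixes E :: "('v \<times> 'v) set" and s :: nat
  assumes sym_E: "sym E"
    and s_pos: "0 < s"
    and no_biclique: "\<And>X Y. finite X \<Longrightarrow> finite Y \<Longrightarrow> card X = s \<Longrightarrow> card Y = s \<Longrightarrow> \<not> X \<times> Y \<subseteq> E"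
begin

text \<open>Otherwise \<open>s\<close> such vertices together have at most
  \<open>card Y / 4 + s\<close> non-neighbours in \<open>Y\<close>, that is at most half of
  \<open>Y\<close>, and \<open>s\<close> vertices of the other half complete a biclique. The summand
  \<open>s\<close> accounts for the vertices themselves, which their closed neighbourhoods contain
  even without a loop.\<close>

lemma few_dominating_vertices:
  assumes X: "finite X" and Y: "finite Y" "4 * s \<le> card Y"
  shows "card {x \<in> X. 4 * s * card (Y - closed_nbh E x) < card Y} < s"
proof (rule ccontr)
  assume "\<not> ?thesis"
  then obtain Z where Z: "Z \<subseteq> {x \<in> X. 4 * s * card (Y - closed_nbh E x) < card Y}" "card Z = s"
    by (meson obtain_subset_with_card_n not_less)
  have finZ: "finite Z" using Z X by (auto intro: finite_subset)
  define C where "C = (\<Union>x\<in>Z. Y - E `` {x})"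
  have "card C \<le> (\<Sum>x\<in>Z. card (Y - E `` {x}))"
    unfolding C_def by (rule card_UN_le[OF finZ])
  then have "4 * s * card C \<le> (\<Sum>x\<in>Z. 4 * s * card (Y - E `` {x}))"
    by (simp add: sum_distrib_left[symmetric])
  also have "\<dots> \<le> (\<Sum>x\<in>Z. card Y + 4 * s)"
  proof (rule sum_mono)
    fix x assume "x \<in> Z"
    then have l: "4 * s * card (Y - closed_nbh E x) < card Y" using Z by auto
    have "card (Y - E `` {x}) \<le> card (insert x (Y - closed_nbh E x))"
      using Y by (intro card_mono) (auto simp: closed_nbh_def)
    also have "\<dots> \<le> Suc (card (Y - closed_nbh E x))" by (rule card_insert_le_m1) auto
    finally have "4 * s * card (Y - E `` {x}) \<le> 4 * s * Suc (card (Y - closed_nbh E x))"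
      by (rule mult_le_mono2)
    then show "4 * s * card (Y - E `` {x}) \<le> card Y + 4 * s" using l by simp
  qed
  also have "\<dots> \<le> s * (2 * card Y)" using Z Y by simp
  finally have "2 * card C \<le> card Y" using s_pos by simp
  moreover have "card (Y - C) = card Y - card C"
    using Y by (intro card_Diff_subset) (auto simp: C_def intro: finite_subset)
  ultimately have "s \<le> card (Y - C)" using Y by linarith
  then obtain D where D: "D \<subseteq> Y - C" "card D = s" by (meson obtain_subset_with_card_n)
  have "Z \<times> D \<subseteq> E" using D by (auto simp: C_def)
  moreover have "finite D" using D Y by (auto intro: finite_subset)
  ultimately show False using no_biclique finZ Z D by blast
qed

text \<open>Values are chosen one index at a time. Discarding at most \<open>q * s\<close> values
  that dominate too much of some other \<open>Y j\<close> leaves at least half of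
  \<open>Y a\<close>, and each remaining value shrinks every other \<open>Y j\<close> by a factor of
  at most \<open>4 * s\<close>. The threshold drops by the same factor; \<open>q\<close> stays fixed
  during the induction and bounds the number of remaining indices throughout.\<close>

lemma card_independent_transversals:
  fixes J :: "'i set"
  assumes "finite J" "card J \<le> q" "\<And>j. j \<in> J \<Longrightarrow> finite (Y j)"
    "\<And>j. j \<in> J \<Longrightarrow> q * (4 * s) ^ card J \<le> card (Y j)"
  shows "(\<Prod>j\<in>J. card (Y j)) \<le> (4 * s) ^ (card J)\<^sup>2 * card (independent_transversals E J Y)"
  using assms
proof (induction J arbitrary: Y rule: finite_induct)
  case empty
  have "independent_transversals E {} Y = {\<lambda>_. undefined}"
    by (auto simp: independent_transversals_def)
  then show ?case by simp
next
  case (insert a J)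
  define k where "k = 4 * s"
  have k: "k \<ge> 4" using s_pos by (simp add: k_def)
  have q: "card J < q" using insert by simp
  have Yfin: "finite (Y j)" if "j \<in> insert a J" for j using insert.prems that by blast
  have Ybig: "q * k ^ Suc (card J) \<le> card (Y j)" if "j \<in> insert a J" for j
    using insert.prems(3)[OF that] insert.hyps by (simp add: k_def)
  have qk: "q * k \<le> q * k ^ Suc (card J)" using k by simp
  have Yk: "k \<le> card (Y j)" if "j \<in> insert a J" for j
    proof -
    have "k \<le> q * k" using q by simp
    then show ?thesis using qk Ybig[OF that] by linarith
  qed
  define L where "L j = {x \<in> Y a. k * card (Y j - closed_nbh E x) < card (Y j)}" for j
  define X where "X = Y a - (\<Union>j\<in>J. L j)"
  have L: "card (L j) \<le> s" if "j \<in> J" for j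
    using few_dominating_vertices[of "Y a" "Y j"] Yfin Yk that
    by (simp add: L_def k_def less_imp_le)
  have "card (\<Union>j\<in>J. L j) \<le> (\<Sum>j\<in>J. card (L j))" by (rule card_UN_le[OF insert.hyps(1)])
  also have "\<dots> \<le> card J * s" using sum_bounded_above[of J "\<lambda>j. card (L j)" s] L by simp
  also have "\<dots> \<le> q * s" using q by simp
  finally have "2 * card (\<Union>j\<in>J. L j) \<le> q * k" by (simp add: k_def)
  also have "\<dots> \<le> card (Y a)" by (rule le_trans[OF qk Ybig]) simp
  finally have "2 * card (\<Union>j\<in>J. L j) \<le> card (Y a)" .
  moreover have "card X = card (Y a) - card (\<Union>j\<in>J. L j)"
    unfolding X_def using Yfin insert.hyps
    by (intro card_Diff_subset) (auto simp: L_def intro: finite_subset)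
  ultimately have cX: "card (Y a) \<le> 2 * card X" by linarith
  have finX: "finite X" using Yfin by (simp add: X_def)
  define Y' where "Y' x j = Y j - closed_nbh E x" for x j
  have Y'k: "card (Y j) \<le> k * card (Y' x j)" if "x \<in> X" "j \<in> J" for x j
    using that by (auto simp: X_def L_def Y'_def not_less)
  have IH: "(\<Prod>j\<in>J. card (Y j)) \<le> k ^ (card J + (card J)\<^sup>2) * card (independent_transversals E J (Y' x))"
    if x: "x \<in> X" for x
  proof -
    have "(\<Prod>j\<in>J. card (Y j)) \<le> (\<Prod>j\<in>J. k * card (Y' x j))"
      using Y'k x by (intro prod_mono) auto
    also have "\<dots> = k ^ card J * (\<Prod>j\<in>J. card (Y' x j))" by (simp add: prod.distrib)
    also have "(\<Prod>j\<in>J. card (Y' x j)) \<le> k ^ (card J)\<^sup>2 * card (independent_transversals E J (Y' x))"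
      unfolding k_def
    proof (rule insert.IH)
      show "card J \<le> q" using q by simp
      fix j assume j: "j \<in> J"
      then show "finite (Y' x j)" using Yfin by (simp add: Y'_def)
      have "k * (q * k ^ card J) \<le> card (Y j)" using Ybig[of j] j by (simp add: mult_ac)
      also have "\<dots> \<le> k * card (Y' x j)" using Y'k x j by blast
      finally show "q * (4 * s) ^ card J \<le> card (Y' x j)" using k by (simp add: k_def)
    qed
    finally show ?thesis by (simp add: power_add mult_ac)
  qed
  define ext where "ext = (\<lambda>(x, f :: 'i \<Rightarrow> 'v). f(a := x))"
  have inj: "inj_on ext (SIGMA x:X. independent_transversals E J (Y' x))"
  proof (rule inj_onI, clarify)
    fix x f y g
    assume f: "f \<in> independent_transversals E J (Y' x)" and g: "g \<in> independent_transversals E J (Y' y)"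
      and eq: "ext (x, f) = ext (y, g)"
    have "x = y" using fun_cong[OF eq, of a] by (simp add: ext_def)
    moreover have "f = g"
    proof (rule ext)
      fix j
      show "f j = g j"
      proof (cases "j = a")
        case True
        then show ?thesis using f g insert.hyps
          by (auto simp: independent_transversals_def PiE_def extensional_def)
      next
        case False
        then show ?thesis using fun_cong[OF eq, of j] by (simp add: ext_def)
      qed
    qed
    ultimately show "x = y \<and> f = g" by simp
  qed
  have img: "ext ` (SIGMA x:X. independent_transversals E J (Y' x))
      \<subseteq> independent_transversals E (insert a J) Y"
  proof clarify
    fix x f assume x: "x \<in> X" and f: "f \<in> independent_transversals E J (Y' x)"
    \<comment> \<open>Both orders of a pair are tested, so symmetry is used to pass from
      \<open>f j\<close> avoiding \<open>x\<close> to \<open>x\<close> avoiding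
      \<open>f j\<close>.\<close>
    have fj: "f j \<in> Y j" "f j \<notin> closed_nbh E x" "x \<notin> closed_nbh E (f j)" if "j \<in> J" for j
      using f that sym_E
      by (auto simp: independent_transversals_def Y'_def PiE_def Pi_def closed_nbh_def dest: symD)
    show "ext (x, f) \<in> independent_transversals E (insert a J) Y"
      using x f fj insert.hyps
      by (auto simp: ext_def independent_transversals_def X_def PiE_def extensional_def Pi_def)
  qed
  have fin: "finite (independent_transversals E (insert a J) Y)"
    using insert.hyps Yfin
    by (auto simp: independent_transversals_def intro!: finite_subset[OF _ finite_PiE[of "insert a J" Y]])
  have fin': "finite (independent_transversals E J (Y' x))" for x
    using insert.hyps Yfin
    by (auto simp: independent_transversals_def Y'_def intro!: finite_subset[OF _ finite_PiE[of J "Y' x"]])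
  have "(\<Prod>j\<in>insert a J. card (Y j)) = card (Y a) * (\<Prod>j\<in>J. card (Y j))"
    using insert.hyps by simp
  also have "\<dots> \<le> 2 * card X * (\<Prod>j\<in>J. card (Y j))" using cX by simp
  also have "\<dots> = 2 * (\<Sum>x\<in>X. \<Prod>j\<in>J. card (Y j))" by simp
  also have "\<dots> \<le> 2 * (\<Sum>x\<in>X. k ^ (card J + (card J)\<^sup>2) * card (independent_transversals E J (Y' x)))"
    using IH by (intro mult_le_mono2 sum_mono) auto
  also have "\<dots> = 2 * k ^ (card J + (card J)\<^sup>2) *
      card (SIGMA x:X. independent_transversals E J (Y' x))"
    using finX fin' by (simp add: card_SigmaI sum_distrib_left[symmetric] mult.assoc)
  also have "\<dots> \<le> 2 * k ^ (card J + (card J)\<^sup>2) * card (independent_transversals E (insert a J) Y)"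
    using card_inj_on_le[OF inj img fin] by (rule mult_le_mono2)
  \<comment> \<open>The 2 lost by halving \<open>Y a\<close> is paid with one more factor
    \<open>k\<close>; then \<open>1 + card J + (card J)^2\<close> is at most
    \<open>(1 + card J)^2\<close>.\<close>
  also have "\<dots> \<le> k * k ^ (card J + (card J)\<^sup>2) * card (independent_transversals E (insert a J) Y)"
    using k by simp
  also have "k * k ^ (card J + (card J)\<^sup>2) = k ^ Suc (card J + (card J)\<^sup>2)" by simp
  also have "\<dots> \<le> k ^ (card (insert a J))\<^sup>2"
    using k insert.hyps by (intro power_increasing) (auto simp: power2_eq_square)
  finally show ?case by (simp add: k_def)
qed

text \<open>In other words, a fraction of at most \<open>card T * s / card U\<close> of all maps is
  bad. Elements of \<open>T\<close> are added one at a time, each allowed to cost a factor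
  \<open>4 * s\<close>; the bound \<open>(4 * s) ^ card T \<le> m\<close> guarantees the
  \<open>4 * s\<close> candidates that \<open>few_dominating_vertices\<close> requires before each
  addition.\<close>

lemma few_small_extension_sets:
  fixes S T :: "'i set"
  assumes "finite T" "finite S" "S \<inter> T = {}" "finite V" "finite U"
    and "\<And>f. f \<in> S \<rightarrow> U \<Longrightarrow> m \<le> card (extension_set V E f S {})"
    and "(4 * s) ^ card T \<le> m"
  shows "card U * card {f \<in> (S \<union> T) \<rightarrow>\<^sub>E U. (4 * s) ^ card T * card (extension_set V E f S T) < m}
     \<le> card T * s * card U ^ card (S \<union> T)"
  using assms(1,3,7)
proof (induction T rule: finite_induct)
  case empty
  have "{f \<in> (S \<union> {}) \<rightarrow>\<^sub>E U. (4 * s) ^ card {} * card (extension_set V E f S {}) < m} = {}"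
    using assms(6) by (auto simp: PiE_def not_less)
  then show ?case by (simp only: card.empty)
next
  case (insert a T)
  define k where "k = 4 * s"
  have k: "k \<ge> 4" using s_pos by (simp add: k_def)
  define W where "W f = extension_set V E f S T" for f
  have finW: "finite (W f)" for f using assms(4) by (simp add: W_def extension_set_def)
  define P where "P = (S \<union> T) \<rightarrow>\<^sub>E U"
  define B where "B = {f \<in> P. k ^ card T * card (W f) < m}"
  define H where "H f = {x \<in> U. k * card (W f - closed_nbh E x) < card (W f)}" for f
  define B' where "B' = {f \<in> (S \<union> insert a T) \<rightarrow>\<^sub>E U.
     k ^ card (insert a T) * card (extension_set V E f S (insert a T)) < m}"
  have a: "a \<notin> S \<union> T" using insert by auto
  have finP: "finite P" using insert.hyps assms by (simp add: P_def finite_PiE)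
  have cP: "card P = card U ^ card (S \<union> T)"
    using insert.hyps assms by (simp add: P_def card_PiE)
  have km: "k ^ Suc (card T) \<le> m" using insert by (simp add: k_def)
  have cong: "extension_set V E f S T = extension_set V E g S T"
    if "\<And>i. i \<in> S \<union> T \<Longrightarrow> f i = g i" for f g :: "'i \<Rightarrow> 'v"
    using that by (auto simp: extension_set_def)
  have IH: "card U * card B \<le> card T * s * card U ^ card (S \<union> T)"
  proof -
    have "k ^ card T \<le> k ^ Suc (card T)" using k by (intro power_increasing) auto
    also note km
    finally have "(4 * s) ^ card T \<le> m" by (simp only: k_def)
    then show ?thesis using insert by (auto simp: B_def P_def W_def k_def)
  qed
  have H: "card (H f) \<le> s" if "f \<in> P - B" for f
  proof -
    have "m \<le> k ^ card T * card (W f)" using that by (auto simp: B_def)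
    from le_trans[OF km this] have "k ^ card T * k \<le> k ^ card T * card (W f)"
      by (simp only: power_Suc2)
    then have "k \<le> card (W f)" using k by simp
    then show ?thesis
      using few_dominating_vertices[of U "W f"] assms finW by (simp add: H_def k_def less_imp_le)
  qed
  define ext where "ext = (\<lambda>(f :: 'i \<Rightarrow> 'v, x). f(a := x))"
  \<comment> \<open>The value at \<open>a\<close> is chosen last: it can make a good restriction bad only if it is one of
    the fewer than \<open>s\<close> vertices dominating \<open>W f\<close>.\<close>
  have sub: "B' \<subseteq> ext ` (B \<times> U \<union> (SIGMA f:P - B. H f))"
  proof
    fix g assume g: "g \<in> B'"
    define f where "f = g(a := undefined)"
    have gx: "g = ext (f, g a)" by (simp add: ext_def f_def)
    have gU: "g a \<in> U" using g by (auto simp: B'_def PiE_def Pi_def)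
    have fP: "f \<in> P" using g a by (auto simp: B'_def P_def f_def PiE_def Pi_def extensional_def)
    have "extension_set V E g S T = W f"
      unfolding W_def using a by (intro cong) (auto simp: f_def)
    then have e: "extension_set V E g S (insert a T) = W f - closed_nbh E (g a)"
      by (auto simp: extension_set_def)
    have "(f, g a) \<in> B \<times> U \<union> (SIGMA f:P - B. H f)"
    proof (cases "f \<in> B")
      case True
      then show ?thesis using gU by simp
    next
      case False
      then have "m \<le> k ^ card T * card (W f)" using fP by (auto simp: B_def)
      moreover have "k ^ card T * (k * card (W f - closed_nbh E (g a))) < m"
        using g e insert.hyps by (simp add: B'_def mult_ac)
      ultimately have "k ^ card T * (k * card (W f - closed_nbh E (g a))) < k ^ card T * card (W f)"
        by linarith
      then have "k * card (W f - closed_nbh E (g a)) < card (W f)" by simp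
      then show ?thesis using fP False gU by (simp add: H_def)
    qed
    then show "g \<in> ext ` (B \<times> U \<union> (SIGMA f:P - B. H f))" using gx by blast
  qed
  have finB: "finite B" using finP by (simp add: B_def)
  have finH: "finite (H f)" for f using assms by (simp add: H_def)
  have fin: "finite (B \<times> U \<union> (SIGMA f:P - B. H f))" using finB finP finH assms by auto
  have "card B' \<le> card (ext ` (B \<times> U \<union> (SIGMA f:P - B. H f)))"
    by (rule card_mono[OF finite_imageI[OF fin] sub])
  also have "\<dots> \<le> card (B \<times> U \<union> (SIGMA f:P - B. H f))" by (rule card_image_le[OF fin])
  also have "\<dots> \<le> card (B \<times> U) + card (SIGMA f:P - B. H f)" by (rule card_Un_le)
  also have "card (SIGMA f:P - B. H f) = (\<Sum>f\<in>P - B. card (H f))"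
    using finP finH by (simp add: card_SigmaI)
  also have "\<dots> \<le> card (P - B) * s" using sum_bounded_above[of "P - B" "\<lambda>f. card (H f)" s] H by simp
  also have "\<dots> \<le> card P * s" using finP by (simp add: card_mono)
  finally have "card B' \<le> card U * card B + card P * s" by (simp add: card_cartesian_product mult_ac)
  then have "card U * card B' \<le> card U * (card U * card B + card P * s)" by (rule mult_le_mono2)
  also have "\<dots> \<le> card U * (card T * s * card U ^ card (S \<union> T) + card P * s)"
    using IH by simp
  also have "\<dots> = card (insert a T) * s * card U ^ card (S \<union> insert a T)"
    using insert.hyps assms(2) a by (simp add: cP algebra_simps)
  finally show ?case by (simp add: B'_def k_def)
qed

section \<open>Placing both sides of the pattern\<close>

lemma exists_independent_transversal:
  assumes "finite J" "card J \<le> q" "\<And>j. j \<in> J \<Longrightarrow> finite (Y j)"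
    "\<And>j. j \<in> J \<Longrightarrow> 0 < card (Y j)"
    "\<And>j. j \<in> J \<Longrightarrow> q * (4 * s) ^ card J \<le> card (Y j)"
  shows "independent_transversals E J Y \<noteq> {}"
proof
  assume "independent_transversals E J Y = {}"
  then have "(\<Prod>j\<in>J. card (Y j)) \<le> 0"
    using card_independent_transversals[of J q Y] assms by simp
  moreover have "0 < (\<Prod>j\<in>J. card (Y j))" using assms by (intro prod_pos) auto
  ultimately show False by simp
qed

text \<open>A union bound over the subsets of \<open>A\<close>: at least a fraction
  \<open>1 / (4 * s) ^ (card A)^2\<close> of the maps are transversals, while each \<open>S\<close>
  spoils at most a fraction \<open>card A * s / card U\<close>, and \<open>card U\<close> is large
  enough for some transversal to survive. Treating all \<open>S\<close> at once lets one
  \<open>f\<close> serve every vertex of the other side of \<open>H\<close>.\<close>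

lemma exists_transversal_with_large_extension_sets:
  fixes A :: "'i set"
  assumes A: "finite A" "card A \<le> h" and V: "finite V" and U: "U \<subseteq> V"
    and common: "\<And>f. f \<in> A \<rightarrow> U \<Longrightarrow> m \<le> card (extension_set V E f A {})"
    and m: "2 ^ h * Suc h * (4 * s) ^ (Suc h)\<^sup>2 < m" "m \<le> card U"
  shows "\<exists>f \<in> independent_transversals E A (\<lambda>_. U).
     \<forall>S\<subseteq>A. m \<le> (4 * s) ^ card (A - S) * card (extension_set V E f S (A - S))"
proof (rule ccontr)
  assume neg: "\<not> ?thesis"
  define k where "k = 4 * s"
  have k: "k \<ge> 1" using s_pos by (simp add: k_def)
  have finU: "finite U" using U V by (rule finite_subset)
  define u where "u = card U"
  define p where "p = card A"
  define Q where "Q = independent_transversals E A (\<lambda>_. U)"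
  define Bad where
    "Bad S = {f \<in> A \<rightarrow>\<^sub>E U. k ^ card (A - S) * card (extension_set V E f S (A - S)) < m}" for S
  have finBad: "finite (Bad S)" for S using A finU by (simp add: Bad_def finite_PiE)
  have u: "0 < u" using m by (simp add: u_def)
  have kh: "Suc h * k ^ e \<le> m" if "e \<le> (Suc h)\<^sup>2" for e
  proof -
    have "Suc h * k ^ e \<le> Suc h * k ^ (Suc h)\<^sup>2" using k that by (intro mult_le_mono2 power_increasing)
    also have "\<dots> \<le> 2 ^ h * (Suc h * k ^ (Suc h)\<^sup>2)" by simp
    also have "\<dots> \<le> m" using m(1) by (simp only: k_def mult.assoc)
    finally show ?thesis .
  qed
  have hh: "h \<le> (Suc h)\<^sup>2" by (simp add: power2_eq_square)
  have Q: "Q \<subseteq> (\<Union>S\<in>Pow A. Bad S)"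
  proof
    fix f assume f: "f \<in> Q"
    then obtain S where "S \<subseteq> A" "k ^ card (A - S) * card (extension_set V E f S (A - S)) < m"
      using neg unfolding Q_def k_def not_le[symmetric] by blast
    then show "f \<in> (\<Union>S\<in>Pow A. Bad S)"
      using f by (auto simp: Q_def Bad_def independent_transversals_def)
  qed
  have bad: "u * card (Bad S) \<le> p * s * u ^ p" if S: "S \<subseteq> A" for S
  proof -
    have SA: "S \<union> (A - S) = A" using S by auto
    have "card (A - S) \<le> p" using A by (simp add: p_def card_mono)
    then have AS: "k ^ card (A - S) \<le> m"
      using kh[of "card (A - S)"] A hh by (simp add: p_def)
    have large: "m \<le> card (extension_set V E f S {})" if f: "f \<in> S \<rightarrow> U" for f
    proof -
      \<comment> \<open>Since \<open>common\<close> speaks of maps on all of \<open>A\<close>,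
        \<open>f\<close> is padded with a constant value; dropping the padding can only enlarge the
        common neighbourhood.\<close>
      obtain x where x: "x \<in> U" using u by (auto simp: u_def card_gt_0_iff)
      define g where "g i = (if i \<in> S then f i else x)" for i
      have "m \<le> card (extension_set V E g A {})" using f x by (intro common) (auto simp: g_def)
      also have "\<dots> \<le> card (extension_set V E f S {})"
        using V S by (intro card_mono) (auto simp: extension_set_def g_def subset_iff)
      finally show ?thesis .
    qed
    have "finite S" using S A finite_subset by blast
    then have "u * card (Bad S) \<le> card (A - S) * s * u ^ p"
      using few_small_extension_sets[of "A - S" S V U m] A(1) V finU AS large
      unfolding SA Bad_def k_def u_def p_def by blast
    also have "\<dots> \<le> p * s * u ^ p" using \<open>card (A - S) \<le> p\<close> by simp
    finally show ?thesis .
  qed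
  have "h * k ^ p \<le> Suc h * k ^ p" by simp
  also have "\<dots> \<le> m" using A hh by (intro kh) (simp add: p_def)
  finally have "u ^ p \<le> k ^ p\<^sup>2 * card Q"
    using card_independent_transversals[of A h "\<lambda>_. U"] A finU m
    by (simp add: p_def u_def Q_def k_def)
  then have "u * u ^ p \<le> k ^ p\<^sup>2 * (u * card Q)" by (simp add: mult_ac)
  also have "u * card Q \<le> u * (\<Sum>S\<in>Pow A. card (Bad S))"
  proof (rule mult_le_mono2)
    have "card Q \<le> card (\<Union>S\<in>Pow A. Bad S)" using A finBad by (intro card_mono[OF _ Q]) auto
    also have "\<dots> \<le> (\<Sum>S\<in>Pow A. card (Bad S))" using A by (intro card_UN_le) simp
    finally show "card Q \<le> (\<Sum>S\<in>Pow A. card (Bad S))" .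
  qed
  also have "\<dots> = (\<Sum>S\<in>Pow A. u * card (Bad S))" by (simp add: sum_distrib_left)
  also have "\<dots> \<le> (\<Sum>S\<in>Pow A. p * s * u ^ p)" using bad by (intro sum_mono) auto
  also have "\<dots> = 2 ^ p * (p * s * u ^ p)" using A by (simp add: card_Pow p_def)
  finally have "u ^ p * u \<le> u ^ p * (2 ^ p * p * (s * k ^ p\<^sup>2))" by (simp add: mult_ac)
  then have "u \<le> 2 ^ p * p * (s * k ^ p\<^sup>2)" using u by simp
  also have "\<dots> \<le> 2 ^ h * Suc h * (k * k ^ p\<^sup>2)"
  proof (intro mult_le_mono)
    show "(2 :: nat) ^ p \<le> 2 ^ h" using A by (simp add: p_def power_increasing)
  qed (use A in \<open>auto simp: p_def k_def\<close>)
  also have "k * k ^ p\<^sup>2 = k ^ Suc (p\<^sup>2)" by simp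
  also have "\<dots> \<le> k ^ (Suc h)\<^sup>2"
  proof (intro power_increasing k)
    have "p\<^sup>2 \<le> h\<^sup>2" using A by (simp add: p_def power_mono)
    then show "Suc (p\<^sup>2) \<le> (Suc h)\<^sup>2" by (simp add: power2_eq_square)
  qed
  finally show False using m by (simp add: u_def k_def)
qed

text \<open>Once \<open>f\<close> is fixed, every candidate set for \<open>B\<close> has at least
  \<open>m / (4 * s) ^ h\<close> vertices, enough for an independent transversal \<open>g\<close>.
  The set \<open>N b\<close> prescribes the neighbours of \<open>b\<close> in
  \<open>A\<close>.\<close>

lemma exists_induced_bipartite_pattern:
  fixes A B :: "'i set"
  assumes A: "finite A" "card A \<le> h" and B: "finite B" "card B \<le> h"
    and V: "finite V" and U: "U \<subseteq> V"
    and common: "\<And>f. f \<in> A \<rightarrow> U \<Longrightarrow> m \<le> card (extension_set V E f A {})"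
    and m: "2 ^ h * Suc h * (4 * s) ^ (Suc h)\<^sup>2 < m" "m \<le> card U"
    and N: "\<And>b. b \<in> B \<Longrightarrow> N b \<subseteq> A"
  obtains f g where "f \<in> independent_transversals E A (\<lambda>_. U)"
    "g \<in> independent_transversals E B (\<lambda>b. extension_set V E f (N b) (A - N b))"
proof -
  obtain f where f: "f \<in> independent_transversals E A (\<lambda>_. U)"
    and large: "\<And>S. S \<subseteq> A \<Longrightarrow> m \<le> (4 * s) ^ card (A - S) * card (extension_set V E f S (A - S))"
    using exists_transversal_with_large_extension_sets[OF A V U common m] by blast
  have "independent_transversals E B (\<lambda>b. extension_set V E f (N b) (A - N b)) \<noteq> {}"
  proof (rule exists_independent_transversal[OF B])
    fix b assume b: "b \<in> B"
    define W where "W = extension_set V E f (N b) (A - N b)"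
    define k where "k = 4 * s"
    have k: "k \<ge> 1" using s_pos by (simp add: k_def)
    define e where "e = card (A - N b)"
    have e: "e \<le> h" using A card_mono[OF A(1), of "A - N b"] by (simp add: e_def)
    have W: "m \<le> k ^ e * card W" using large[OF N[OF b]] by (simp add: W_def k_def e_def)
    show "finite W" using V by (simp add: W_def extension_set_def)
    show "0 < card W" using W m by (cases "card W") auto
    have "k ^ e * (h * k ^ card B) = h * k ^ (e + card B)" by (simp add: power_add)
    \<comment> \<open>At most \<open>h\<close> factors \<open>k\<close> are lost through
      \<open>f\<close> and at most \<open>h\<close> are required for \<open>B\<close>;
      \<open>2 * h\<close> is below \<open>(Suc h)^2\<close>.\<close>
    also have "\<dots> \<le> (2 ^ h * Suc h) * k ^ (Suc h)\<^sup>2"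
    proof (intro mult_le_mono power_increasing k)
      show "h \<le> 2 ^ h * Suc h" by (simp add: trans_le_add2 le_trans[of h "Suc h"])
      show "e + card B \<le> (Suc h)\<^sup>2" using e B by (simp add: power2_eq_square)
    qed
    also have "\<dots> \<le> k ^ e * card W" using W m by (simp add: k_def)
    finally show "h * (4 * s) ^ card B \<le> card W" using k by (simp add: k_def)
  qed
  then show thesis using f that by blast
qed

end

section \<open>Dependent random choice and degree sums\<close>

text \<open>Pairs of a \<open>t\<close>-tuple and a vertex adjacent to all its entries are counted
  twice. If no \<open>U\<close> works, a tuple has at most \<open>r\<close> common neighbours unless
  it lies inside the common neighbourhood, of fewer than \<open>m\<close> vertices, of some
  \<open>I\<close>-tuple. There are at most \<open>card V ^ card I * m ^ t\<close> such exceptions,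
  each contributing at most \<open>card V\<close>; this yields the two terms in
  \<open>big\<close>.\<close>

lemma dependent_random_choice:
  fixes E :: "('v \<times> 'v) set" and I :: "'i set"
  assumes V: "finite V" and I: "finite I" and sym: "sym E"
    and big: "card V ^ t * r + card V ^ Suc (card I) * m ^ t < (\<Sum>x\<in>V. card {y \<in> V. (x, y) \<in> E} ^ t)"
  shows "\<exists>U\<subseteq>V. r < card U \<and> (\<forall>f \<in> I \<rightarrow> U. m \<le> card (extension_set V E f I {}))"
proof (rule ccontr)
  assume neg: "\<not> ?thesis"
  define P where "P = {..<t} \<rightarrow>\<^sub>E V"
  \<comment> \<open>Random choice is replaced by counting tuples \<open>v\<close>; \<open>B\<close> collects those whose common
    neighbourhood \<open>U v\<close> contains some \<open>I\<close>-tuple with few common neighbours.\<close>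
  define U where "U v = {x \<in> V. \<forall>i<t. (x, v i) \<in> E}" for v :: "nat \<Rightarrow> 'v"
  define C where "C f = extension_set V E f I {}" for f :: "'i \<Rightarrow> 'v"
  define F where "F = {f \<in> I \<rightarrow>\<^sub>E V. card (C f) < m}"
  define B where "B = (\<Union>f\<in>F. {..<t} \<rightarrow>\<^sub>E C f)"
  have finC: "finite (C f)" for f using V by (simp add: C_def extension_set_def)
  have finF: "finite F" using V I by (simp add: F_def finite_PiE)
  have finP: "finite P" using V by (simp add: P_def finite_PiE)
  have finB: "finite B" using finF finC by (auto simp: B_def finite_PiE)
  have cP: "card P = card V ^ t" by (simp add: P_def card_PiE)
  have "card F \<le> card (I \<rightarrow>\<^sub>E V)" using V I by (intro card_mono) (auto simp: F_def finite_PiE)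
  then have cF: "card F \<le> card V ^ card I" using I by (simp add: card_PiE)
  have "card B \<le> (\<Sum>f\<in>F. card ({..<t} \<rightarrow>\<^sub>E C f))" unfolding B_def by (rule card_UN_le[OF finF])
  also have "\<dots> \<le> (\<Sum>f\<in>F. m ^ t)"
    by (intro sum_mono) (auto simp: card_PiE F_def intro!: power_mono)
  also have "\<dots> \<le> card V ^ card I * m ^ t" using cF by simp
  finally have cB: "card B \<le> card V ^ card I * m ^ t" .
  have small: "card (U v) \<le> r" if v: "v \<in> P - B" for v
  proof (rule ccontr)
    assume "\<not> card (U v) \<le> r"
    then obtain f where f: "f \<in> I \<rightarrow> U v" "card (C f) < m"
      using neg unfolding C_def by (auto simp: not_le U_def) 
    define g where "g = restrict f I"
    have C: "C g = C f" by (auto simp: C_def g_def extension_set_def)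
    have "g \<in> F" using f C by (auto simp: F_def g_def U_def)
    moreover have "v \<in> {..<t} \<rightarrow>\<^sub>E C g"
      using v f unfolding C by (auto simp: P_def C_def U_def extension_set_def PiE_def Pi_def)
    ultimately show False using v by (auto simp: B_def)
  qed
  have UV: "card (U v) \<le> card V" for v using V by (auto simp: U_def intro: card_mono)
  have "(\<Sum>x\<in>V. card {y \<in> V. (x, y) \<in> E} ^ t) = (\<Sum>x\<in>V. card {v \<in> P. \<forall>i<t. (x, v i) \<in> E})"
  proof (rule sum.cong[OF refl])
    fix x
    have "{v \<in> P. \<forall>i<t. (x, v i) \<in> E} = {..<t} \<rightarrow>\<^sub>E {y \<in> V. (x, y) \<in> E}"
      by (auto simp: P_def PiE_def Pi_def)
    then show "card {y \<in> V. (x, y) \<in> E} ^ t = card {v \<in> P. \<forall>i<t. (x, v i) \<in> E}"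
      by (simp add: card_PiE)
  qed
  also have "\<dots> = (\<Sum>v\<in>P. card (U v))"
    unfolding U_def by (rule sum_multicount_gen[symmetric]) (auto simp: finP V)
  also have "\<dots> \<le> (\<Sum>v\<in>(P - B) \<union> B. card (U v))"
    using finP finB by (intro sum_mono2) auto
  also have "\<dots> = (\<Sum>v\<in>P - B. card (U v)) + (\<Sum>v\<in>B. card (U v))"
    using finP finB by (intro sum.union_disjoint) auto
  also have "\<dots> \<le> card (P - B) * r + card B * card V"
    using sum_bounded_above[of "P - B" "\<lambda>v. card (U v)" r] small
      sum_bounded_above[of B "\<lambda>v. card (U v)" "card V"] UV by (simp add: add_mono)
  also have "\<dots> \<le> card V ^ t * r + card V ^ card I * m ^ t * card V"
    using card_mono[OF finP, of "P - B"] cP cB by (intro add_mono mult_right_mono) auto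
  finally show False using big by (simp add: mult_ac)
qed

text \<open>Vertices with \<open>d x < Q ^ N\<close> contribute at most
  \<open>card V * Q ^ N = Q ^ (2 * N + 1)\<close>, half of the assumed bound. As no degree exceeds
  \<open>Q ^ Suc N\<close>, at least \<open>Q ^ N\<close> other vertices remain, each contributing
  at least \<open>(Q ^ N) ^ t\<close>.\<close>

lemma sum_power_ge:
  fixes d :: "'v \<Rightarrow> nat" and Q :: real
  assumes V: "finite V" "real (card V) = Q ^ Suc N" and Q: "0 < Q"
    and d: "\<And>x. x \<in> V \<Longrightarrow> d x \<le> card V"
    and big: "2 * Q ^ (2 * N + 1) \<le> real (\<Sum>x\<in>V. d x)"
  shows "Q ^ (N * Suc t) \<le> real (\<Sum>x\<in>V. d x ^ t)"
proof -
  define X where "X = {x \<in> V. Q ^ N \<le> real (d x)}"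
  have finX: "finite X" using V by (simp add: X_def)
  have "real (\<Sum>x\<in>V. d x) = (\<Sum>x\<in>X. real (d x)) + (\<Sum>x\<in>V - X. real (d x))"
    using V by (subst sum.subset_diff[of X V]) (auto simp: X_def)
  also have "\<dots> \<le> (\<Sum>x\<in>X. Q ^ Suc N) + (\<Sum>x\<in>V. Q ^ N)"
  proof (rule add_mono)
    show "(\<Sum>x\<in>X. real (d x)) \<le> (\<Sum>x\<in>X. Q ^ Suc N)"
      using d V(2)[symmetric] by (intro sum_mono) (auto simp: X_def simp del: power_Suc)
    have "(\<Sum>x\<in>V - X. real (d x)) \<le> (\<Sum>x\<in>V - X. Q ^ N)"
      by (intro sum_mono) (auto simp: X_def)
    also have "\<dots> \<le> (\<Sum>x\<in>V. Q ^ N)" using V Q by (intro sum_mono2) auto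
    finally show "(\<Sum>x\<in>V - X. real (d x)) \<le> (\<Sum>x\<in>V. Q ^ N)" .
  qed
  also have "\<dots> = card X * Q ^ Suc N + Q ^ Suc N * Q ^ N" using V by simp
  also have "Q ^ Suc N * Q ^ N = Q ^ (2 * N + 1)" by (simp add: power_add[symmetric] mult_2)
  finally have "Q ^ (2 * N + 1) \<le> card X * Q ^ Suc N" using big by linarith
  also have "Q ^ (2 * N + 1) = Q ^ N * Q ^ Suc N" by (simp add: power_add[symmetric] mult_2)
  finally have X: "Q ^ N \<le> card X" using Q by simp
  have "Q ^ (N * Suc t) = Q ^ N * (Q ^ N) ^ t" by (simp add: power_mult[symmetric] power_add[symmetric])
  also have "\<dots> \<le> card X * (Q ^ N) ^ t" using X Q by (intro mult_right_mono) auto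
  also have "\<dots> = (\<Sum>x\<in>X. (Q ^ N) ^ t)" by simp
  also have "\<dots> \<le> (\<Sum>x\<in>X. real (d x) ^ t)"
    using Q by (intro sum_mono power_mono) (auto simp: X_def)
  also have "\<dots> \<le> (\<Sum>x\<in>V. real (d x) ^ t)" using V by (intro sum_mono2) (auto simp: X_def)
  finally show ?thesis by simp
qed

section \<open>From counting to induced copies\<close>

lemma biclique_free_parcs:
  fixes G :: "'v pair_pre_digraph"
  assumes G: "pair_graph G" and s: "0 < s" and free: "\<not> contains_subgraph G (complete_bipartite s s)"
  shows "biclique_free (parcs G) s"
proof
  interpret G: pair_graph G by fact
  have cb: "pair_graph (complete_bipartite s s)"
    by unfold_locales (auto simp: complete_bipartite_def symmetric_def sym_def)
  show "sym (parcs G)" using G.sym_arcs by (simp add: symmetric_def)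
  show "0 < s" by fact
  fix X Y :: "'v set" assume XY: "finite X" "finite Y" "card X = s" "card Y = s"
  show "\<not> X \<times> Y \<subseteq> parcs G"
  proof
    assume sub: "X \<times> Y \<subseteq> parcs G"
    obtain f g where f: "bij_betw f {..<s} X" and g: "bij_betw g {..<s} Y"
      using ex_bij_betw_nat_finite[OF XY(1)] ex_bij_betw_nat_finite[OF XY(2)] XY
      by (auto simp: atLeast0LessThan)
    \<comment> \<open>A common vertex would carry a loop; disjointness makes the map on
      \<open>Inl\<close> and \<open>Inr\<close> vertices injective.\<close>
    have dis: "X \<inter> Y = {}" using sub G.no_loops by fastforce
    have rev: "(y, x) \<in> parcs G" if "x \<in> X" "y \<in> Y" for x y
      using sub that \<open>sym (parcs G)\<close> by (auto dest: symD)
    have fX: "f i \<in> X" "g i \<in> Y" if "i < s" for i using that f g by (auto simp: bij_betw_def)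
    have "contains_subgraph G (complete_bipartite s s)"
      unfolding contains_subgraph_iff[OF G cb]
    proof (intro exI conjI)
      show "inj_on (case_sum f g) (pverts (complete_bipartite s s))"
      proof (rule inj_onI)
        fix u v assume uv: "u \<in> pverts (complete_bipartite s s)" "v \<in> pverts (complete_bipartite s s)"
          "case_sum f g u = case_sum f g v"
        have "f i \<noteq> g j" if "i < s" "j < s" for i j
          using fX(1)[OF that(1)] fX(2)[OF that(2)] dis by force
        moreover have "i = j" if "f i = f j" "i < s" "j < s" for i j
          using f that by (auto simp: bij_betw_def inj_on_def)
        moreover have "i = j" if "g i = g j" "i < s" "j < s" for i j
          using g that by (auto simp: bij_betw_def inj_on_def)
        ultimately show "u = v"
          using uv by (cases u; cases v) (auto simp: complete_bipartite_def dest: sym)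
      qed
      show "case_sum f g ` pverts (complete_bipartite s s) \<subseteq> pverts G"
        using fX sub G.in_arcsD1 G.in_arcsD2 by (fastforce simp: complete_bipartite_def)
      show "\<forall>(u, v)\<in>parcs (complete_bipartite s s). (case_sum f g u, case_sum f g v) \<in> parcs G"
        using fX sub rev by (auto simp: complete_bipartite_def)
    qed
    then show False using free by simp
  qed
qed

text \<open>Dependent random choice with \<open>r = m\<close> supplies \<open>U\<close>; then
  \<open>f\<close> places one side of \<open>H\<close> in \<open>U\<close>, \<open>g\<close> places
  the other in the candidate sets, and the two maps are glued together.\<close>

lemma contains_induced_if_degree_power_sum_large:
  assumes G: "pair_graph G" and H: "pair_graph H" "bipartite H" and s: "0 < s"
    and free: "\<not> contains_subgraph G (complete_bipartite s s)"
    and h: "card (pverts H) \<le> h" and m: "2 ^ h * Suc h * (4 * s) ^ (Suc h)\<^sup>2 < m"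
    and n: "card (pverts G) \<ge> 1"
    and big: "card (pverts G) ^ t * m + card (pverts G) ^ Suc h * m ^ t
      < (\<Sum>x\<in>pverts G. card {y \<in> pverts G. (x, y) \<in> parcs G} ^ t)"
  shows "contains_induced G H"
proof -
  interpret G: pair_graph G by fact
  interpret H: pair_graph H by fact
  interpret biclique_free "parcs G" s by (rule biclique_free_parcs[OF G s free])
  obtain A B where AB: "pverts H = A \<union> B" "A \<inter> B = {}" "parcs H \<subseteq> A \<times> B \<union> B \<times> A"
    using H(2) unfolding bipartite_def by blast
  have fin: "finite A" "finite B" using AB(1) H.finite_verts by auto
  have cards: "card A \<le> h" "card B \<le> h"
    using h AB(1) card_mono[OF H.finite_verts, of A] card_mono[OF H.finite_verts, of B] by auto
  have V: "finite (pverts G)" by simp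
  \<comment> \<open>The hypothesis \<open>big\<close> uses \<open>h\<close> instead of
    \<open>card A\<close>, so it does not depend on the bipartition chosen here.\<close>
  have "card (pverts G) ^ Suc (card A) \<le> card (pverts G) ^ Suc h"
    using n cards by (intro power_increasing) auto
  then have "card (pverts G) ^ t * m + card (pverts G) ^ Suc (card A) * m ^ t
      < (\<Sum>x\<in>pverts G. card {y \<in> pverts G. (x, y) \<in> parcs G} ^ t)"
    using big by (meson add_left_mono le_less_trans mult_right_mono zero_le)
  from dependent_random_choice[OF V fin(1) sym_E this]
  obtain U where U: "U \<subseteq> pverts G" "m \<le> card U"
    and common: "\<And>f. f \<in> A \<rightarrow> U \<Longrightarrow> m \<le> card (extension_set (pverts G) (parcs G) f A {})"
    using less_imp_le by blast
  define N where "N b = {a \<in> A. (a, b) \<in> parcs H}" for b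
  obtain f g where f: "f \<in> independent_transversals (parcs G) A (\<lambda>_. U)"
    and g: "g \<in> independent_transversals (parcs G) B (\<lambda>b. extension_set (pverts G) (parcs G) f (N b) (A - N b))"
    using exists_induced_bipartite_pattern[OF fin(1) cards(1) fin(2) cards(2) V U(1) common m U(2), of N]
    by (auto simp: N_def)
  have sH: "(a, b) \<in> parcs H \<longleftrightarrow> (b, a) \<in> parcs H" for a b
    using H.sym_arcs by (auto simp: symmetric_def dest: symD)
  have sG: "(x, y) \<in> parcs G \<longleftrightarrow> (y, x) \<in> parcs G" for x y using sym_E by (auto dest: symD)
  have irr: "(x, x) \<notin> parcs G" for x using G.no_loops[of "(x, x)"] by auto
  have fA: "f a \<in> pverts G" if "a \<in> A" for a
    using f U(1) that by (auto simp: independent_transversals_def PiE_def Pi_def)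
  have gB: "g b \<in> extension_set (pverts G) (parcs G) f (N b) (A - N b)" if "b \<in> B" for b
    using g that by (auto simp: independent_transversals_def PiE_def Pi_def)
  have ff: "f a' \<noteq> f a" "(f a, f a') \<notin> parcs G" if "a \<in> A" "a' \<in> A" "a \<noteq> a'" for a a'
    using f that by (auto simp: independent_transversals_def closed_nbh_def)
  have gg: "g b' \<noteq> g b" "(g b, g b') \<notin> parcs G" if "b \<in> B" "b' \<in> B" "b \<noteq> b'" for b b'
    using g that by (auto simp: independent_transversals_def closed_nbh_def)
  have fg: "(f a, g b) \<in> parcs G \<longleftrightarrow> (a, b) \<in> parcs H" if "a \<in> A" "b \<in> B" for a b
    using gB[OF that(2)] that(1) by (auto simp: extension_set_def N_def closed_nbh_def)
  \<comment> \<open>If \<open>(a, b)\<close> is an arc of \<open>H\<close>, equality would give a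
    loop in \<open>G\<close>; otherwise the closed neighbourhood in \<open>extension_set\<close>
    excludes it.\<close>
  have fg': "f a \<noteq> g b" if "a \<in> A" "b \<in> B" for a b
  proof
    assume eq: "f a = g b"
    then have "(a, b) \<notin> parcs H" using fg[OF that] irr by simp
    then have "a \<in> A - N b" using that(1) by (simp add: N_def)
    then have "g b \<notin> closed_nbh (parcs G) (f a)" using gB[OF that(2)] by (simp add: extension_set_def)
    then show False using eq by (simp add: closed_nbh_def)
  qed
  have AA: "(a, a') \<notin> parcs H" if "a \<in> A" "a' \<in> A" for a a' using AB that by auto
  have BB: "(a, a') \<notin> parcs H" if "a \<in> B" "a' \<in> B" for a a' using AB that by auto
  define F where "F x = (if x \<in> A then f x else g x)" for x
  have F: "F x = f x" if "x \<in> A" for x using that by (simp add: F_def)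
  have F': "F x = g x" if "x \<in> B" for x using that AB(2) by (auto simp: F_def)
  show ?thesis
    unfolding contains_induced_iff[OF G H(1)]
  proof (intro exI conjI ballI)
    show "inj_on F (pverts H)"
    proof (rule inj_onI)
      fix u v assume "u \<in> pverts H" "v \<in> pverts H" and eq: "F u = F v"
      then consider "u \<in> A" "v \<in> A" | "u \<in> A" "v \<in> B" | "u \<in> B" "v \<in> A" | "u \<in> B" "v \<in> B"
        unfolding AB(1) by blast
      then show "u = v"
      proof cases
        case 1 then show ?thesis using ff(1)[of u v] eq F by auto
      next
        case 2 then show ?thesis using fg'[of u v] eq F F' by auto
      next
        case 3 then show ?thesis using fg'[of v u] eq F F' by auto
      next
        case 4 then show ?thesis using gg(1)[of u v] eq F' by auto
      qed
    qed
    show "F ` pverts H \<subseteq> pverts G"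
      unfolding AB(1) using fA gB F F' by (auto simp: extension_set_def)
    fix u v assume "u \<in> pverts H" "v \<in> pverts H"
    then consider "u \<in> A" "v \<in> A" | "u \<in> A" "v \<in> B" | "u \<in> B" "v \<in> A" | "u \<in> B" "v \<in> B"
      unfolding AB(1) by blast
    then show "(u, v) \<in> parcs H \<longleftrightarrow> (F u, F v) \<in> parcs G"
    proof cases
      case 1 then show ?thesis using ff(2)[of u v] AA[of u v] irr by (cases "u = v") (simp_all add: F)
    next
      case 2 then show ?thesis using fg[of u v] by (simp add: F F')
    next
      case 3 then show ?thesis using fg[of v u] sH[of u v] sG[of "F u" "F v"] by (simp add: F F')
    next
      case 4 then show ?thesis using gg(2)[of u v] BB[of u v] irr by (cases "u = v") (simp_all add: F')
    qed
  qed
qed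

section \<open>Choice of parameters\<close>

text \<open>
  With \<open>Q = n\<^sup>\<epsilon>\<close> and \<open>\<epsilon> = 1/(N + 1)\<close>, all powers of \<open>n\<close> become natural powers of \<open>Q\<close>;
  in particular \<open>n\<^sup>2\<^sup>-\<^sup>\<epsilon> = Q ^ (2 * N + 1)\<close>.
\<close>
lemma card_edges_le:
  fixes G :: "'v pair_pre_digraph" and H :: "'a pair_pre_digraph" and Q :: real
  assumes G: "pair_graph G" and H: "pair_graph H" "bipartite H" and s: "0 < s"
    and free: "\<not> contains_subgraph G (complete_bipartite s s)" "\<not> contains_induced G H"
    and h: "card (pverts H) = h" and K: "K = (Suc h)\<^sup>2" and N: "N = 2 * K + 2 * h + 3"
    and c: "c = 2 ^ h * Suc h * 4 ^ K + 2"
    and n: "real (card (pverts G)) = Q ^ Suc N" and Q: "0 < Q"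
  shows "real (card (edges G)) \<le> real c * real s ^ 4 * Q ^ (2 * N + 1)"
proof (rule ccontr)
  assume neg: "\<not> ?thesis"
  interpret G: pair_graph G by fact
  define V where "V = pverts G"
  define d where "d x = card {y \<in> V. (x, y) \<in> parcs G}" for x
  have V: "finite V" "real (card V) = Q ^ Suc N" using n by (simp_all add: V_def)
  have "edges G = (\<lambda>(u, v). {u, v}) ` parcs G" by (auto simp: edges_def)
  then have "card (edges G) \<le> card (parcs G)" by (simp add: card_image_le)
  have "parcs G = (SIGMA x:V. {y \<in> V. (x, y) \<in> parcs G})"
    using G.in_arcsD1 G.in_arcsD2 by (auto simp: V_def)
  then have "card (parcs G) = card (SIGMA x:V. {y \<in> V. (x, y) \<in> parcs G})" by (rule arg_cong)
  also have "\<dots> = (\<Sum>x\<in>V. d x)" using V unfolding d_def by (intro card_SigmaI) auto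
  finally have edges: "card (edges G) \<le> (\<Sum>x\<in>V. d x)"
    using \<open>card (edges G) \<le> card (parcs G)\<close> by simp
  have dV: "d x \<le> card V" for x using V by (auto simp: d_def intro: card_mono)
  have cs: "c \<le> c * s ^ 4" using s by simp
  \<comment> \<open>The negated bound is compared with \<open>n^2 = Q * Q ^ (2 * N + 1)\<close>. It
    survives only if \<open>c * s ^ 4 < Q\<close>, so from here on every polynomial in
    \<open>s\<close> is bounded by a power of \<open>Q\<close>.\<close>
  have "real c * real s ^ 4 * Q ^ (2 * N + 1) < real (\<Sum>x\<in>V. d x)" using neg edges by linarith
  also have "\<dots> \<le> real (card V) * real (card V)"
    unfolding of_nat_mult[symmetric] of_nat_le_iff
    using sum_bounded_above[of V d "card V"] dV by simp
  also have "\<dots> = Q * Q ^ (2 * N + 1)" unfolding V by (simp add: power_add mult_2)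
  finally have Qc: "real (c * s ^ 4) < Q" using Q by simp
  have "2 \<le> real (c * s ^ 4)" using cs c by linarith
  then have Q2: "2 < Q" using Qc by linarith
  have "2 * Q ^ (2 * N + 1) \<le> real (c * s ^ 4) * Q ^ (2 * N + 1)"
    using \<open>2 \<le> real (c * s ^ 4)\<close> Q by (intro mult_right_mono) auto
  also have "\<dots> = real c * real s ^ 4 * Q ^ (2 * N + 1)" by (simp only: of_nat_mult of_nat_power)
  also have "\<dots> \<le> real (\<Sum>x\<in>V. d x)" using neg edges by linarith
  finally have dsum: "2 * Q ^ (2 * N + 1) \<le> real (\<Sum>x\<in>V. d x)" .
  \<comment> \<open>With this \<open>t\<close>, the term \<open>n ^ Suc h * m ^ t\<close> equals
    \<open>n ^ Suc h * (m^2) ^ Suc h\<close>, which is at most \<open>n ^ t\<close> as soon as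
    \<open>m^2 \<le> n\<close>.\<close>
  define t where "t = 2 * Suc h"
  define m where "m = 2 ^ h * Suc h * (4 * s) ^ K + 1"
  have "1 \<le> s ^ K" using s by simp
  then have "m + 1 \<le> c * s ^ K" by (simp add: m_def c algebra_simps power_mult_distrib)
  also have "\<dots> \<le> c ^ K * (s ^ 4) ^ K"
    using s K c by (intro mult_le_mono power_mono self_le_power) auto
  also have "\<dots> = (c * s ^ 4) ^ K" by (simp add: power_mult_distrib)
  finally have "real (m + 1) \<le> real ((c * s ^ 4) ^ K)" by (simp only: of_nat_le_iff)
  also have "\<dots> = real (c * s ^ 4) ^ K" by (simp only: of_nat_power)
  also have "\<dots> \<le> Q ^ K" using Qc by (intro power_mono) auto
  finally have m: "real (m + 1) \<le> Q ^ K" .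
  have "real (m\<^sup>2) \<le> (Q ^ K)\<^sup>2" using m by (simp add: power_mono)
  also have "\<dots> = Q ^ (K * 2)" by (simp add: power_mult)
  also have "\<dots> \<le> real (card V)" unfolding V using Q2 N by (intro power_increasing) auto
  finally have m2: "m\<^sup>2 \<le> card V" by (simp only: of_nat_le_iff)
  have "card V ^ Suc h * m ^ t = card V ^ Suc h * (m\<^sup>2) ^ Suc h"
    by (simp only: t_def power_mult)
  also have "\<dots> \<le> card V ^ Suc h * card V ^ Suc h" using m2 by (intro mult_le_mono2 power_mono) auto
  also have "\<dots> = card V ^ t" by (simp only: t_def power_add[symmetric] mult_2)
  finally have "card V ^ t * m + card V ^ Suc h * m ^ t \<le> card V ^ t * (m + 1)" by simp
  then have "real (card V ^ t * m + card V ^ Suc h * m ^ t) \<le> real (card V) ^ t * real (m + 1)"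
    by (metis of_nat_le_iff of_nat_mult of_nat_power)
  also have "\<dots> \<le> (Q ^ Suc N) ^ t * Q ^ K" unfolding V using m Q by (intro mult_left_mono) auto
  also have "\<dots> = Q ^ (Suc N * t + K)" by (simp only: power_add power_mult)
  \<comment> \<open>The definition of \<open>N\<close> serves twice:
    \<open>2 * K \<le> Suc N\<close> gave \<open>m^2 \<le> n\<close>, and \<open>t + K < N\<close>
    gives this strict inequality.\<close>
  also have "\<dots> < Q ^ (N * Suc t)"
  proof (rule power_strict_increasing)
    have "t + K < N" by (simp add: t_def N)
    then show "Suc N * t + K < N * Suc t" by simp
  qed (use Q2 in simp)
  also have "\<dots> \<le> real (\<Sum>x\<in>V. d x ^ t)" by (rule sum_power_ge[OF V Q dV dsum])
  finally have "card V ^ t * m + card V ^ Suc h * m ^ t < (\<Sum>x\<in>V. d x ^ t)"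
    by (simp only: of_nat_less_iff)
  moreover have "2 ^ h * Suc h * (4 * s) ^ (Suc h)\<^sup>2 < m" by (simp add: m_def K)
  moreover have "real (card V) > 0" unfolding V using Q by simp
  then have "card V \<ge> 1" by simp
  ultimately have "contains_induced G H"
    using contains_induced_if_degree_power_sum_large[OF G H s free(1), of h m t] h
    by (simp add: V_def d_def)
  then show False using free by simp
qed

theorem theorem1p4:
  fixes H :: "'a pair_pre_digraph"
  assumes "pair_graph H" and "bipartite H"
  shows "\<exists>\<epsilon> c :: real. 0 < \<epsilon> \<and> \<epsilon> \<le> 1/2 \<and> c > 1 \<and>
    (\<forall>s n :: nat. s \<ge> 1 \<longrightarrow> n \<ge> 1 \<longrightarrow>
      real (ex_ind n (complete_bipartite s s) H) \<le> c * real s ^ 4 * real n powr (2 - \<epsilon>))"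
proof -
  define h where "h = card (pverts H)"
  define K where "K = (Suc h)\<^sup>2"
  define N where "N = 2 * K + 2 * h + 3"
  \<comment> \<open>The summand 2 gives \<open>c > 1\<close>, lets low degrees account for at most
    half of the degree sum, and absorbs the additive constants in
    \<open>m + 1 \<le> c * s ^ K\<close>.\<close>
  define c :: nat where "c = 2 ^ h * Suc h * 4 ^ K + 2"
  define \<epsilon> :: real where "\<epsilon> = 1 / Suc N"
  have "real (ex_ind n (complete_bipartite s s) H) \<le> real c * real s ^ 4 * real n powr (2 - \<epsilon>)"
    if s: "s \<ge> 1" and n: "n \<ge> 1" for s n
  proof -
    define Q where "Q = real n powr \<epsilon>"
    have Q: "0 < Q" using n by (simp add: Q_def)
    have nQ: "real n = Q ^ Suc N" using n by (simp add: Q_def \<epsilon>_def powr_power del: power_Suc)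
    have "real (2 * N + 1) * \<epsilon> = 2 - \<epsilon>" by (simp add: \<epsilon>_def field_simps)
    then have Qe: "Q ^ (2 * N + 1) = real n powr (2 - \<epsilon>)"
      unfolding Q_def using n by (subst powr_power) (auto simp: mult_ac)
    define b where "b = real c * real s ^ 4 * real n powr (2 - \<epsilon>)"
    define M where "M = {card (edges G) | G :: nat pair_pre_digraph.
     pair_graph G \<and> card (pverts G) = n \<and>
     \<not> contains_subgraph G (complete_bipartite s s) \<and> \<not> contains_induced G H}"
    have M: "real e \<le> b" if eM: "e \<in> M" for e
    proof -
      obtain G :: "nat pair_pre_digraph" where G: "pair_graph G" "card (pverts G) = n"
        "\<not> contains_subgraph G (complete_bipartite s s)" "\<not> contains_induced G H"
        and e: "e = card (edges G)"
        using eM unfolding M_def by blast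
      have "0 < s" "real (card (pverts G)) = Q ^ Suc N" using s G nQ by auto
      from card_edges_le[OF G(1) assms this(1) G(3,4) h_def[symmetric] K_def N_def c_def this(2) Q]
      show ?thesis by (simp only: e b_def Qe)
    qed
    have b: "0 \<le> b" by (simp add: b_def)
    \<comment> \<open>The supremum is taken in the naturals, so the real bound is rounded down
      first; for empty \<open>M\<close> the supremum is 0.\<close>
    have "Sup M \<le> nat \<lfloor>b\<rfloor>"
    proof (cases "M = {}")
      case False
      then show ?thesis using M by (intro cSup_least) (auto simp: le_nat_floor)
    qed (simp add: Sup_nat_def)
    then have "real (Sup M) \<le> b" using b by linarith
    then show ?thesis by (simp add: ex_ind_def M_def b_def)
  qed
  moreover have "0 < \<epsilon>" "\<epsilon> \<le> 1/2" by (simp_all add: \<epsilon>_def N_def field_simps)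
  moreover have "1 < c" by (simp add: c_def)
  then have "1 < real c" by simp
  ultimately show ?thesis by (intro exI[of _ \<epsilon>] exI[of _ "real c"]) blast
qed

end
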